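(* Every extreme point $q=(q_1,q_2)$ of the convex set $$\Big\{q=(q_1,q_2):\ q_1\preceq_w\hat q_2;\ q_1,q_2:[0,1]\to[0,1]\text{ are nondecreasing and left-continuous}\Big\}$$ satisfies $q_1=\hat q_2\,\mathbf 1_{[k,1]}$ for some $k\in[0,1]$.
   Context: For nondecreasing $g_1,g_2:[0,1]\to\mathbb R$, $g_2$ weakly majorizes $g_1$, written $g_1\preceq_w g_2$, if $\int_x^1 g_1(z)\,dz\le\int_x^1 g_2(z)\,dz$ for all $x\in[0,1]$. For a nondecreasing left-continuous $g:[0,1]\to[0,1]$, $g^{-1}(z):=\inf\{x\in[0,1]:g(x)>z\}$ (with $\inf\emptyset=1$), and the conjugate of $g$ is $\hat g(z):=1-g^{-1}(1-z)$. Functions equal almost everywhere are identified, and equalities between functions are understood almost everywhere. *)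

theory Defs
  imports "HOL-Analysis.Analysis"
begin

text \<open>Functions on \<open>[0,1]\<close> are total functions of type \<^typ>\<open>real \<Rightarrow> real\<close>
  of which only the values on \<^term>\<open>{0..1::real}\<close> matter.\<close>

definition left_cont_mono :: "(real \<Rightarrow> real) set" where
  "left_cont_mono = {g. g ` {0..1} \<subseteq> {0..1} \<and> mono_on {0..1} g \<and>
     (\<forall>x\<in>{0<..1}. continuous (at_left x) g)}"

definition weakly_majorized :: "(real \<Rightarrow> real) \<Rightarrow> (real \<Rightarrow> real) \<Rightarrow> bool"
    (infix "\<preceq>\<^sub>w" 50) where
  "g1 \<preceq>\<^sub>w g2 \<longleftrightarrow> (\<forall>x\<in>{0..1}. integral {x..1} g1 \<le> integral {x..1} g2)"

definition gen_inverse :: "(real \<Rightarrow> real) \<Rightarrow> real \<Rightarrow> real" where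
  "gen_inverse g z = (if {x\<in>{0..1}. g x > z} = {} then 1 else Inf {x\<in>{0..1}. g x > z})"

definition conjugate :: "(real \<Rightarrow> real) \<Rightarrow> real \<Rightarrow> real" where
  "conjugate g z = 1 - gen_inverse g (1 - z)"

definition feasible :: "((real \<Rightarrow> real) \<times> (real \<Rightarrow> real)) set" where
  "feasible = {(q1, q2). q1 \<in> left_cont_mono \<and> q2 \<in> left_cont_mono \<and> q1 \<preceq>\<^sub>w conjugate q2}"

definition ae_eq :: "(real \<Rightarrow> real) \<Rightarrow> (real \<Rightarrow> real) \<Rightarrow> bool" where
  "ae_eq f g \<longleftrightarrow> (AE x\<in>{0..1} in lborel. f x = g x)"

text \<open>The real vector space of functions on \<open>[0,1]\<close> modulo equality almost everywhere.
  No measurability is imposed; \<^const>\<open>feasible\<close> consists of monotone, hence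
  measurable, functions.\<close>

quotient_type ae_fun = "real \<Rightarrow> real" / ae_eq
  morphisms rep_ae_fun ae_class
proof (rule equivpI)
  show "reflp ae_eq" by (simp add: reflp_def ae_eq_def)
  show "symp ae_eq" by (simp add: symp_def ae_eq_def eq_commute)
  show "transp ae_eq"
    unfolding transp_def ae_eq_def
  proof (intro allI impI)
    fix f g h :: "real \<Rightarrow> real"
    assume "AE x\<in>{0..1} in lborel. f x = g x" "AE x\<in>{0..1} in lborel. g x = h x"
    then show "AE x\<in>{0..1} in lborel. f x = h x" by eventually_elim auto
  qed
qed

instantiation ae_fun :: real_vector
begin

lift_definition zero_ae_fun :: ae_fun is "\<lambda>x. 0" .

lift_definition plus_ae_fun :: "ae_fun \<Rightarrow> ae_fun \<Rightarrow> ae_fun" is "\<lambda>f g x. f x + g x"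
  unfolding ae_eq_def by (elim AE_mp) auto

lift_definition minus_ae_fun :: "ae_fun \<Rightarrow> ae_fun \<Rightarrow> ae_fun" is "\<lambda>f g x. f x - g x"
  unfolding ae_eq_def by (elim AE_mp) auto

lift_definition uminus_ae_fun :: "ae_fun \<Rightarrow> ae_fun" is "\<lambda>f x. - f x"
  unfolding ae_eq_def by (elim AE_mp) auto

lift_definition scaleR_ae_fun :: "real \<Rightarrow> ae_fun \<Rightarrow> ae_fun" is "\<lambda>c f x. c * f x"
  unfolding ae_eq_def by (elim AE_mp) auto

instance
  by standard (transfer, simp add: ae_eq_def algebra_simps)+

end

definition feasible_classes :: "(ae_fun \<times> ae_fun) set" where
  "feasible_classes = map_prod ae_class ae_class ` feasible"

end

theory Submission imports Defs
begin

text \<open>Put \<open>p y = 1 - q2 (1 - y)\<close>. Then \<open>conjugate q2\<close> is the generalized inverse of \<open>p\<close>, and by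
  Young's inequality, whose equality case is \<open>y = conjugate q2 x\<close>, the pair is feasible iff the
  Border slack \<open>1 - x y - \<integral>\<^sub>x\<^sup>1 q1 - \<integral>\<^sub>y\<^sup>1 p\<close> is nonnegative on the unit square. This condition is
  linear and symmetric in \<open>q1\<close> and \<open>p\<close>.

  The slack is strictly submodular, so its zero set is a closed chain, which contains \<open>(1, 1)\<close>.
  At an extreme point this chain has no gap between corners \<open>(a, c)\<close> and \<open>(b, d)\<close>: otherwise
  \<open>q1\<close> takes values in \<open>(c, d)\<close> and \<open>p\<close> takes values in \<open>(a, b)\<close>, and they can be perturbed in
  opposite directions, at these values only, with the changes of the two integrals cancelling.
  Hence the chain projects onto an interval \<open>[b, 1]\<close>, where \<open>q1\<close> must agree with the inverse of
  \<open>p\<close>. Below its least point \<open>(b, d)\<close> no constraint binds, so perturbing \<open>q1\<close> or \<open>p\<close> alone shows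
  that \<open>q1\<close> takes only the values \<open>0\<close> and \<open>d\<close> on \<open>[0, b)\<close>, where the inverse of \<open>p\<close> is constantly
  \<open>d\<close>.\<close>

section \<open>Border slack\<close>

definition slack :: "(real \<Rightarrow> real) \<Rightarrow> (real \<Rightarrow> real) \<Rightarrow> real \<Rightarrow> real \<Rightarrow> real" where
  "slack u v x y = 1 - x * y - integral {x..1} u - integral {y..1} v"

text \<open>A triangular bump of slope 1. It lies below \<open>max 0 (y - t)\<close> if
  \<open>d \<le> y\<close> and below \<open>max 0 (t - y)\<close> if \<open>y \<le> c\<close>;
  through these bounds the slack controls it.\<close>

definition tent :: "real \<Rightarrow> real \<Rightarrow> real \<Rightarrow> real" where
  "tent c d t = max 0 (min (t - c) (d - t))"

text \<open>Perturbations act on values, \<open>u \<mapsto> u \<plusminus> f \<circ> u\<close>: the Lipschitz bound keeps monotonicity, and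
  vanishing at 0 and 1 keeps the range in \<open>[0,1]\<close>.\<close>

definition perturbation :: "(real \<Rightarrow> real) \<Rightarrow> bool" where
  "perturbation f \<longleftrightarrow> (\<forall>s t. \<bar>f s - f t\<bar> \<le> \<bar>s - t\<bar>) \<and> f 0 = 0 \<and> f 1 = 0"

lemma slack_commute: "slack u v x y = slack v u y x"
  by (simp add: slack_def mult.commute)

lemma tent_nonneg: "0 \<le> tent c d t"
  by (simp add: tent_def)

lemma perturbation_tent:
  assumes "0 \<le> c" "d \<le> 1" "\<bar>e\<bar> \<le> 1"
  shows "perturbation (\<lambda>t. e * tent c d t)"
proof -
  have "\<bar>tent c d s - tent c d t\<bar> \<le> \<bar>s - t\<bar>" for s t
    by (auto simp: tent_def)
  then have "\<bar>e * tent c d s - e * tent c d t\<bar> \<le> \<bar>s - t\<bar>" for s t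
    using assms(3) mult_mono[of "\<bar>e\<bar>" 1 "\<bar>tent c d s - tent c d t\<bar>" "\<bar>s - t\<bar>"]
    by (simp add: abs_mult flip: right_diff_distrib)
  then show ?thesis
    using assms by (auto simp: perturbation_def tent_def)
qed

lemma mono_on_add_perturbation:
  fixes u :: "real \<Rightarrow> real"
  assumes "mono_on A u" "perturbation f"
  shows "mono_on A (\<lambda>t. u t + f (u t))" "mono_on A (\<lambda>t. u t - f (u t))"
proof -
  have "f (u s) - f (u t) \<le> u t - u s \<and> f (u t) - f (u s) \<le> u t - u s"
    if "s \<in> A" "t \<in> A" "s \<le> t" for s t
    using assms that unfolding perturbation_def
    by (smt (verit, best) mono_onD)
  then show "mono_on A (\<lambda>t. u t + f (u t))" "mono_on A (\<lambda>t. u t - f (u t))"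
    by (smt (verit, best) mono_onI)+
qed

lemma integrable_perturbation:
  fixes u :: "real \<Rightarrow> real"
  assumes "mono_on {a..b} u" "perturbation f"
  shows "(\<lambda>t. f (u t)) integrable_on {a..b}"
proof -
  \<comment> \<open>The composition is a difference of two monotone functions.\<close>
  have "(\<lambda>t. (u t + f (u t)) - u t) integrable_on {a..b}"
    by (intro integrable_diff integrable_on_mono_on mono_on_add_perturbation assms)
  then show ?thesis by simp
qed

lemma perturbation_range:
  assumes "perturbation f" "t \<in> {0..1}"
  shows "t + f t \<in> {0..1}" "t - f t \<in> {0..1}"
proof -
  have "\<bar>f t - f 0\<bar> \<le> \<bar>t - 0\<bar>" "\<bar>f t - f 1\<bar> \<le> \<bar>t - 1\<bar>" "f 0 = 0" "f 1 = 0"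
    using assms(1) unfolding perturbation_def by blast+
  then show "t + f t \<in> {0..1}" "t - f t \<in> {0..1}"
    using assms(2) by auto
qed

text \<open>Supplies the minimizer of \<open>slack u v x y\<close> in \<open>x\<close>, whose
  derivative is \<open>u x - y\<close> almost everywhere.\<close>

lemma mono_crossing:
  fixes u :: "real \<Rightarrow> real"
  assumes "mono_on {0..1} u"
  obtains z where "z \<in> {0..1}" "\<And>t. t \<in> {0..1} \<Longrightarrow> t < z \<Longrightarrow> u t \<le> y"
    "\<And>t. t \<in> {0..1} \<Longrightarrow> z < t \<Longrightarrow> y \<le> u t"
proof
  \<comment> \<open>Inserting \<open>0\<close> keeps the set nonempty when \<open>u\<close> never
    falls below \<open>y\<close>.\<close>
  define S where "S = insert 0 {t \<in> {0..1}. u t < y}"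
  have bdd: "bdd_above S" and S: "S \<subseteq> {0..1}" "S \<noteq> {}"
    by (auto simp: S_def intro: bdd_aboveI[of _ 1])
  show "Sup S \<in> {0..1}"
    using S bdd by (auto intro!: cSup_least cSup_upper2[of 0] simp: S_def)
  show "u t \<le> y" if "t \<in> {0..1}" "t < Sup S" for t
  proof -
    obtain s where "s \<in> S" "t < s"
      using less_cSupD[OF S(2) \<open>t < Sup S\<close>] by blast
    then show ?thesis
      using that mono_onD[OF assms, of t s] by (auto simp: S_def)
  qed
  show "y \<le> u t" if "t \<in> {0..1}" "Sup S < t" for t
    using that cSup_upper[OF _ bdd, of t] by (force simp: S_def)
qed

text \<open>Bisection: after \<open>n\<close> halvings each piece has length
  \<open>(y - x) / 2 ^ n\<close>, while the increments of \<open>g\<close> telescope, so the total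
  bound tends to 0.\<close>

lemma eq_of_bracketed_increments:
  fixes E g :: "real \<Rightarrow> real"
  assumes inc: "\<And>x y. a \<le> x \<Longrightarrow> x \<le> y \<Longrightarrow> y \<le> b \<Longrightarrow> \<bar>E y - E x\<bar> \<le> (y - x) * (g y - g x)"
    and "a \<le> b"
  shows "E a = E b"
proof -
  have "\<bar>E y - E x\<bar> \<le> (y - x) * (g y - g x) / 2 ^ n" if "a \<le> x" "x \<le> y" "y \<le> b" for x y n
    using that
  proof (induction n arbitrary: x y)
    case (Suc n)
    define m where "m = (x + y) / 2"
    have "\<bar>E m - E x\<bar> \<le> (m - x) * (g m - g x) / 2 ^ n"
         "\<bar>E y - E m\<bar> \<le> (y - m) * (g y - g m) / 2 ^ n"
      using Suc.prems by (intro Suc.IH; simp add: m_def)+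
    moreover have "(m - x) * (g m - g x) / 2 ^ n + (y - m) * (g y - g m) / 2 ^ n
        = (y - x) * (g y - g x) / 2 ^ Suc n"
      by (simp add: m_def field_simps)
    ultimately show ?case by linarith
  qed (use inc in auto)
  then have "\<bar>E b - E a\<bar> \<le> (b - a) * (g b - g a) / 2 ^ n" for n
    using \<open>a \<le> b\<close> by blast
  moreover have "(\<lambda>n. (b - a) * (g b - g a) / 2 ^ n) \<longlonglongrightarrow> 0"
    using tendsto_mult[OF tendsto_const LIMSEQ_inverse_realpow_zero[of 2], of "(b - a) * (g b - g a)"]
    by (simp add: divide_inverse)
  ultimately have "\<bar>E b - E a\<bar> \<le> 0"
    by (intro LIMSEQ_le_const[where X = "\<lambda>n. (b - a) * (g b - g a) / 2 ^ n"]) auto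
  then show ?thesis by simp
qed

text \<open>Here \<open>u\<close> stands for \<open>q1\<close> and \<open>v\<close> for the function
  \<open>p\<close>. The conditions are symmetric, so facts about \<open>u\<close> and the first
  coordinate transfer to \<open>v\<close> and the second.\<close>

locale border_pair =
  fixes u v :: "real \<Rightarrow> real"
  assumes mono_u: "mono_on {0..1} u" and mono_v: "mono_on {0..1} v"
    and range_u: "\<And>t. t \<in> {0..1} \<Longrightarrow> u t \<in> {0..1}"
    and range_v: "\<And>t. t \<in> {0..1} \<Longrightarrow> v t \<in> {0..1}"
    and slack_nonneg: "\<And>x y. x \<in> {0..1} \<Longrightarrow> y \<in> {0..1} \<Longrightarrow> 0 \<le> slack u v x y"
begin

lemma border_pair_swap: "border_pair v u"
  using mono_u mono_v range_u range_v slack_nonneg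
  by unfold_locales (auto simp: slack_commute[of v u])

lemma integrable_u: "0 \<le> x \<Longrightarrow> y \<le> 1 \<Longrightarrow> u integrable_on {x..y}"
  by (rule integrable_on_mono_on) (auto intro: mono_on_subset[OF mono_u])

lemma integrable_perturbation_u:
  "perturbation f \<Longrightarrow> 0 \<le> x \<Longrightarrow> y \<le> 1 \<Longrightarrow> (\<lambda>t. f (u t)) integrable_on {x..y}"
  by (rule integrable_perturbation) (auto intro: mono_on_subset[OF mono_u])

lemma integrable_pos_part:
  assumes "0 \<le> x" "z \<le> 1"
  shows "(\<lambda>t. max 0 (u t - y)) integrable_on {x..z}" "(\<lambda>t. max 0 (y - u t)) integrable_on {x..z}"
proof -
  have "mono_on {x..z} u"
    using assms by (intro mono_on_subset[OF mono_u]) auto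
  then have "mono_on {x..z} (\<lambda>t. max 0 (u t - y))"
    by (force simp: mono_on_def)
  then show *: "(\<lambda>t. max 0 (u t - y)) integrable_on {x..z}"
    by (rule integrable_on_mono_on)
  have "(\<lambda>t. (y - u t) + max 0 (u t - y)) integrable_on {x..z}"
    using assms by (intro integrable_add integrable_diff * integrable_u) auto
  moreover have "(y - u t) + max 0 (u t - y) = max 0 (y - u t)" for t
    by auto
  ultimately show "(\<lambda>t. max 0 (y - u t)) integrable_on {x..z}" by simp
qed

lemma slack_diff:
  assumes "0 \<le> x" "x \<le> z" "z \<le> 1"
  shows "slack u v x y - slack u v z y = integral {x..z} (\<lambda>t. y - u t)"
proof -
  have "integral {x..z} u + integral {z..1} u = integral {x..1} u"
    using assms by (intro Henstock_Kurzweil_Integration.integral_combine integrable_u) auto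
  moreover have "integral {x..z} (\<lambda>t. y - u t) = y * (z - x) - integral {x..z} u"
    using assms by (subst integral_diff) (auto intro: integrable_u)
  ultimately show ?thesis
    by (simp add: slack_def algebra_simps)
qed

lemma slack_decreasing:
  assumes "0 \<le> x" "x \<le> z" "z \<le> 1" "\<And>t. x < t \<Longrightarrow> t < z \<Longrightarrow> u t \<le> y"
  shows "slack u v z y \<le> slack u v x y"
proof -
  have "0 \<le> integral {x..z} (\<lambda>t. max 0 (y - u t))"
    by (rule integral_nonneg) (use assms integrable_pos_part in auto)
  also have "\<dots> = integral {x..z} (\<lambda>t. y - u t)"
    by (rule integral_spike[of "{x, z}"]) (use assms(4) in \<open>auto intro!: max_absorb2[symmetric]\<close>)
  finally show ?thesis using slack_diff[OF assms(1-3), of y] by simp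
qed

lemma slack_increasing:
  assumes "0 \<le> x" "x \<le> z" "z \<le> 1" "\<And>t. x < t \<Longrightarrow> t < z \<Longrightarrow> y \<le> u t"
  shows "slack u v x y \<le> slack u v z y"
proof -
  have "0 \<le> integral {x..z} (\<lambda>t. max 0 (u t - y))"
    by (rule integral_nonneg) (use assms integrable_pos_part in auto)
  also have "\<dots> = integral {x..z} (\<lambda>t. u t - y)"
    by (rule integral_spike[of "{x, z}"]) (use assms(4) in \<open>auto intro!: max_absorb2[symmetric]\<close>)
  also have "\<dots> = - integral {x..z} (\<lambda>t. y - u t)"
    by (simp flip: integral_neg)
  finally show ?thesis using slack_diff[OF assms(1-3), of y] by simp
qed

text \<open>The positive part of \<open>y - u\<close> vanishes beyond the crossing \<open>z\<close>
  of level \<open>y\<close>. For \<open>x \<le> z\<close> its integral is therefore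
  \<open>slack u v x y - slack u v z y\<close>, and the second term is nonnegative.\<close>

lemma integral_below_le_slack:
  assumes "x \<in> {0..1}" "y \<in> {0..1}"
  shows "integral {x..1} (\<lambda>t. max 0 (y - u t)) \<le> slack u v x y"
proof -
  obtain z where z: "z \<in> {0..1}" "\<And>t. t \<in> {0..1} \<Longrightarrow> t < z \<Longrightarrow> u t \<le> y"
      "\<And>t. t \<in> {0..1} \<Longrightarrow> z < t \<Longrightarrow> y \<le> u t"
    using mono_crossing[OF mono_u] by metis
  have zero: "integral {w..1} (\<lambda>t. max 0 (y - u t)) = 0" if "z \<le> w" for w
    using that z by (subst integral_spike[of "{z}" _ "\<lambda>_. 0"]) force+
  show ?thesis
  proof (cases "x \<le> z")
    case True
    have "integral {x..z} (\<lambda>t. max 0 (y - u t)) = integral {x..z} (\<lambda>t. y - u t)"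
      using assms z by (intro integral_spike[of "{z}"]) (auto intro!: max_absorb2 max_absorb2[symmetric])
    moreover have "integral {x..z} (\<lambda>t. max 0 (y - u t)) + integral {z..1} (\<lambda>t. max 0 (y - u t))
        = integral {x..1} (\<lambda>t. max 0 (y - u t))"
      using assms z True
      by (intro Henstock_Kurzweil_Integration.integral_combine integrable_pos_part) auto
    ultimately show ?thesis
      using slack_diff[of x z y] slack_nonneg[OF z(1) assms(2)] zero[of z] True z(1) assms(1)
      by simp
  next
    case False
    then show ?thesis using zero[of x] slack_nonneg[OF assms] by simp
  qed
qed

lemma integral_above_le_slack:
  assumes "x \<in> {0..1}" "y \<in> {0..1}"
  shows "integral {0..x} (\<lambda>t. max 0 (u t - y)) \<le> slack u v x y"
proof -
  obtain z where z: "z \<in> {0..1}" "\<And>t. t \<in> {0..1} \<Longrightarrow> t < z \<Longrightarrow> u t \<le> y"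
      "\<And>t. t \<in> {0..1} \<Longrightarrow> z < t \<Longrightarrow> y \<le> u t"
    using mono_crossing[OF mono_u] by metis
  have zero: "integral {0..w} (\<lambda>t. max 0 (u t - y)) = 0" if "w \<le> z" for w
    using that z by (subst integral_spike[of "{z}" _ "\<lambda>_. 0"]) force+
  show ?thesis
  proof (cases "z \<le> x")
    case True
    have "integral {z..x} (\<lambda>t. max 0 (u t - y)) = integral {z..x} (\<lambda>t. u t - y)"
      using assms z by (intro integral_spike[of "{z}"]) (auto intro!: max_absorb2 max_absorb2[symmetric])
    also have "\<dots> = - integral {z..x} (\<lambda>t. y - u t)"
      by (simp flip: integral_neg)
    finally have "integral {z..x} (\<lambda>t. max 0 (u t - y)) = - integral {z..x} (\<lambda>t. y - u t)" .
    moreover have "integral {0..z} (\<lambda>t. max 0 (u t - y)) + integral {z..x} (\<lambda>t. max 0 (u t - y))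
        = integral {0..x} (\<lambda>t. max 0 (u t - y))"
      using assms z True
      by (intro Henstock_Kurzweil_Integration.integral_combine integrable_pos_part) auto
    ultimately show ?thesis
      using slack_diff[of z x y] slack_nonneg[OF z(1) assms(2)] zero[of z] True z(1) assms(1)
      by simp
  next
    case False
    then show ?thesis using zero[of x] slack_nonneg[OF assms] by simp
  qed
qed

lemma integrable_tent:
  assumes "0 \<le> c" "d \<le> 1" "0 \<le> x" "z \<le> 1"
  shows "(\<lambda>t. tent c d (u t)) integrable_on {x..z}"
  using integrable_perturbation_u[OF perturbation_tent[of c d 1]] assms by simp

text \<open>A tent on values below \<open>y\<close> is dominated by the positive part of
  \<open>y - u\<close>, one on values above \<open>y\<close> by that of \<open>u - y\<close>. This
  covers perturbations near the corners of a gap, where the slack itself may be arbitrarily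
  small.\<close>

lemma tent_integral_le_slack:
  assumes "x \<in> {0..1}" "y \<in> {0..1}" "0 \<le> c" "d \<le> 1"
  shows "d \<le> y \<Longrightarrow> integral {x..1} (\<lambda>t. tent c d (u t)) \<le> slack u v x y"
    and "y \<le> c \<Longrightarrow> integral {0..x} (\<lambda>t. tent c d (u t)) \<le> slack u v x y"
proof -
  assume "d \<le> y"
  then have "tent c d t \<le> max 0 (y - t)" for t by (auto simp: tent_def)
  then have "integral {x..1} (\<lambda>t. tent c d (u t)) \<le> integral {x..1} (\<lambda>t. max 0 (y - u t))"
    using assms by (intro integral_le integrable_tent integrable_pos_part) auto
  then show "integral {x..1} (\<lambda>t. tent c d (u t)) \<le> slack u v x y"
    using integral_below_le_slack[OF assms(1,2)] by simp
next
  assume "y \<le> c"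
  then have "tent c d t \<le> max 0 (t - y)" for t by (auto simp: tent_def)
  then have "integral {0..x} (\<lambda>t. tent c d (u t)) \<le> integral {0..x} (\<lambda>t. max 0 (u t - y))"
    using assms by (intro integral_le integrable_tent integrable_pos_part) auto
  then show "integral {0..x} (\<lambda>t. tent c d (u t)) \<le> slack u v x y"
    using integral_above_le_slack[OF assms(1,2)] by simp
qed

lemma tent_integral_split:
  assumes "x \<in> {0..1}" "0 \<le> c" "d \<le> 1"
  shows "integral {0..1} (\<lambda>t. tent c d (u t))
    = integral {0..x} (\<lambda>t. tent c d (u t)) + integral {x..1} (\<lambda>t. tent c d (u t))"
  using assms integrable_tent[of c d 0 1]
    Henstock_Kurzweil_Integration.integral_combine[of 0 x 1 "\<lambda>t. tent c d (u t)"]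
  by simp

lemma tent_integral_bounds:
  assumes "x \<in> {0..1}" "0 \<le> c" "d \<le> 1"
  shows "0 \<le> integral {x..1} (\<lambda>t. tent c d (u t))"
    and "integral {x..1} (\<lambda>t. tent c d (u t)) \<le> integral {0..1} (\<lambda>t. tent c d (u t))"
    and "integral {0..1} (\<lambda>t. tent c d (u t)) \<le> 1"
proof -
  show "0 \<le> integral {x..1} (\<lambda>t. tent c d (u t))"
    using assms by (intro integral_nonneg integrable_tent) (auto simp: tent_nonneg)
  have "0 \<le> integral {0..x} (\<lambda>t. tent c d (u t))"
    using assms by (intro integral_nonneg integrable_tent) (auto simp: tent_nonneg)
  then show "integral {x..1} (\<lambda>t. tent c d (u t)) \<le> integral {0..1} (\<lambda>t. tent c d (u t))"
    using tent_integral_split[OF assms] by simp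
  have "tent c d (u t) \<le> 1" if "t \<in> {0..1}" for t
    using range_u[OF that] assms by (auto simp: tent_def)
  then have "integral {0..1} (\<lambda>t. tent c d (u t)) \<le> integral {0..1} (\<lambda>t::real. 1)"
    using assms by (intro integral_le integrable_tent) auto
  then show "integral {0..1} (\<lambda>t. tent c d (u t)) \<le> 1" by simp
qed

text \<open>Monotonicity traps \<open>u\<close> between \<open>u s\<close> and \<open>u t\<close> on
  all of \<open>{s..t}\<close>, where the tent is then bounded away from 0.\<close>

lemma tent_integral_pos:
  assumes "0 \<le> c" "d \<le> 1" "0 \<le> s" "s < t" "t \<le> 1" "c < u s" "u t < d"
  shows "0 < integral {0..1} (\<lambda>t. tent c d (u t))"
proof -
  define \<delta> where "\<delta> = min (u s - c) (d - u t)"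
  have "\<delta> \<le> tent c d (u r)" if "r \<in> {s..t}" for r
    using mono_onD[OF mono_u, of s r] mono_onD[OF mono_u, of r t] that assms
    by (auto simp: \<delta>_def tent_def)
  then have "integral {s..t} (\<lambda>_. \<delta>) \<le> integral {s..t} (\<lambda>t. tent c d (u t))"
    using assms by (intro integral_le integrable_tent) auto
  also have "\<dots> \<le> integral {0..1} (\<lambda>t. tent c d (u t))"
    using assms by (intro integral_subset_le integrable_tent) (auto simp: tent_nonneg)
  finally have "(t - s) * \<delta> \<le> integral {0..1} (\<lambda>t. tent c d (u t))"
    using assms by simp
  moreover have "0 < (t - s) * \<delta>"
    using assms by (auto simp: \<delta>_def)
  ultimately show ?thesis by linarith
qed

lemma continuous_on_slack:
  "continuous_on ({0..1} \<times> {0..1}) (\<lambda>p. slack u v (fst p) (snd p))"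
proof -
  interpret swap: border_pair v u by (rule border_pair_swap)
  have *: "continuous_on {0..1} (\<lambda>x. integral {x..1} u)" "continuous_on {0..1} (\<lambda>y. integral {y..1} v)"
    by (intro indefinite_integral_continuous_1' integrable_u swap.integrable_u; simp)+
  have "continuous_on ({0..1} \<times> {0..1}) (\<lambda>p. integral {fst p..1} u)"
    by (rule continuous_on_compose2[OF *(1)]) (auto intro!: continuous_intros)
  moreover have "continuous_on ({0..1} \<times> {0..1}) (\<lambda>p. integral {snd p..1} v)"
    by (rule continuous_on_compose2[OF *(2)]) (auto intro!: continuous_intros)
  ultimately show ?thesis
    unfolding slack_def by (intro continuous_intros)
qed

section \<open>The tight set: compactness, chain order, slices\<close>

definition tight :: "(real \<times> real) set" where
  "tight = {p \<in> {0..1} \<times> {0..1}. slack u v (fst p) (snd p) = 0}"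

lemma mem_tight [simp]: "(x, y) \<in> tight \<longleftrightarrow> x \<in> {0..1} \<and> y \<in> {0..1} \<and> slack u v x y = 0"
  by (auto simp: tight_def)

lemma compact_tight: "compact tight"
proof -
  have "closed ({0..1::real} \<times> {0..1::real})"
    by (intro closed_Times closed_atLeastAtMost)
  then have "closed tight"
    using continuous_closed_preimage_constant[OF continuous_on_slack] by (simp add: tight_def)
  moreover have "tight \<subseteq> {0..1} \<times> {0..1}" by (auto simp: tight_def)
  moreover have "compact ({0..1::real} \<times> {0..1::real})"
    by (intro compact_Times compact_Icc)
  ultimately show ?thesis
    by (metis compact_Int_closed inf.absorb_iff2)
qed

text \<open>The slack attains its minimum on a compact set, and this is positive off the tight set.
  The cap at 1 lets \<open>\<mu>\<close> serve as a scaling factor in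
  \<open>perturbation_tent\<close>.\<close>

lemma slack_bounded_below:
  assumes "closed K" "K \<inter> tight = {}"
  obtains \<mu> where "0 < \<mu>" "\<mu> \<le> 1"
    "\<And>x y. x \<in> {0..1} \<Longrightarrow> y \<in> {0..1} \<Longrightarrow> (x, y) \<in> K \<Longrightarrow> \<mu> \<le> slack u v x y"
proof -
  define L where "L = K \<inter> ({0..1} \<times> {0..1})"
  have "compact L"
    unfolding L_def by (intro closed_Int_compact assms compact_Times compact_Icc)
  have "\<exists>m>0. \<forall>p\<in>L. m \<le> slack u v (fst p) (snd p)"
  proof (cases "L = {}")
    case False
    have "continuous_on L (\<lambda>p. slack u v (fst p) (snd p))"
      by (rule continuous_on_subset[OF continuous_on_slack]) (auto simp: L_def)
    then obtain p where p: "p \<in> L" "\<forall>q\<in>L. slack u v (fst p) (snd p) \<le> slack u v (fst q) (snd q)"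
      using continuous_attains_inf[OF \<open>compact L\<close> False] by blast
    have "p \<in> {0..1} \<times> {0..1}" "p \<notin> tight"
      using p(1) assms(2) by (auto simp: L_def)
    then have "0 < slack u v (fst p) (snd p)"
      using slack_nonneg[of "fst p" "snd p"] by (auto simp: tight_def less_le)
    then show ?thesis using p(2) by blast
  qed (auto intro: exI[of _ 1])
  then obtain m where m: "0 < m" "\<And>p. p \<in> L \<Longrightarrow> m \<le> slack u v (fst p) (snd p)" by blast
  show ?thesis
  proof (rule that[of "min 1 m"])
    show "min 1 m \<le> slack u v x y" if "x \<in> {0..1}" "y \<in> {0..1}" "(x, y) \<in> K" for x y
      using m(2)[of "(x, y)"] that by (simp add: L_def)
  qed (use m(1) in auto)
qed

text \<open>Strict submodularity: for two points in decreasing position, passing to the crossed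
  corners lowers the sum of slacks by the area of the rectangle, which would make it
  negative.\<close>

lemma tight_chain:
  assumes "(x, y) \<in> tight" "(x', y') \<in> tight" "x < x'"
  shows "y \<le> y'"
proof (rule ccontr)
  assume "\<not> y \<le> y'"
  then have "0 < (x' - x) * (y - y')" using assms(3) by simp
  moreover have "slack u v x y' + slack u v x' y
      = slack u v x y + slack u v x' y' - (x' - x) * (y - y')"
    by (simp add: slack_def algebra_simps)
  ultimately show False
    using assms slack_nonneg[of x y'] slack_nonneg[of x' y] by auto
qed

text \<open>In \<open>x\<close> the slack decreases up to the crossing of level \<open>y\<close> and
  increases afterwards, so on a segment it is at most its larger end value.\<close>

lemma tight_between:
  assumes "(a, y) \<in> tight" "(b, y) \<in> tight" "a \<le> x" "x \<le> b"
  shows "(x, y) \<in> tight"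
proof -
  obtain z where z: "z \<in> {0..1}" "\<And>t. t \<in> {0..1} \<Longrightarrow> t < z \<Longrightarrow> u t \<le> y"
      "\<And>t. t \<in> {0..1} \<Longrightarrow> z < t \<Longrightarrow> y \<le> u t"
    using mono_crossing[OF mono_u] by metis
  have "slack u v x y \<le> 0"
  proof (cases "x \<le> z")
    case True
    then have "slack u v x y \<le> slack u v a y"
      using assms z by (intro slack_decreasing) auto
    then show ?thesis using assms by simp
  next
    case False
    then have "slack u v x y \<le> slack u v b y"
      using assms z by (intro slack_increasing) auto
    then show ?thesis using assms by simp
  qed
  then show ?thesis
    using assms slack_nonneg[of x y] by auto
qed

text \<open>A tight point minimizes the slack along its horizontal line, so the derivative
  \<open>u t - y\<close> has the matching sign on either side.\<close>

lemma tight_sides: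
  assumes "(x, y) \<in> tight" "t \<in> {0..1}"
  shows "t < x \<Longrightarrow> u t \<le> y" and "x < t \<Longrightarrow> y \<le> u t"
proof -
  \<comment> \<open>Estimating by the value of \<open>u\<close> at an endpoint yields the inequality
    at every point, not only almost everywhere.\<close>
  have neg: "integral {r..s} (\<lambda>t. y - u t) \<le> (s - r) * (y - u r)"
      and pos: "(s - r) * (y - u s) \<le> integral {r..s} (\<lambda>t. y - u t)"
    if "0 \<le> r" "r \<le> s" "s \<le> 1" for r s
  proof -
    have "integral {r..s} (\<lambda>t. y - u t) \<le> integral {r..s} (\<lambda>_. y - u r)"
      using that by (intro integral_le integrable_diff integrable_u)
        (auto intro: mono_onD[OF mono_u])
    then show "integral {r..s} (\<lambda>t. y - u t) \<le> (s - r) * (y - u r)"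
      using that by simp
    have "integral {r..s} (\<lambda>_. y - u s) \<le> integral {r..s} (\<lambda>t. y - u t)"
      using that by (intro integral_le integrable_diff integrable_u)
        (auto intro: mono_onD[OF mono_u])
    then show "(s - r) * (y - u s) \<le> integral {r..s} (\<lambda>t. y - u t)"
      using that by simp
  qed
  show "u t \<le> y" if "t < x"
  proof -
    have "0 \<le> (x - t) * (y - u t)"
      using slack_diff[of t x y] neg[of t x] slack_nonneg[of t y] assms that by auto
    then show ?thesis using that by (simp add: zero_le_mult_iff)
  qed
  show "y \<le> u t" if "x < t"
  proof -
    have "(t - x) * (y - u t) \<le> 0"
      using slack_diff[of x t y] pos[of x t] slack_nonneg[of t y] assms that by auto
    then show ?thesis using that by (simp add: mult_le_0_iff)
  qed
qed

lemma one_one_tight: "(1, 1) \<in> tight"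
  by (simp add: slack_def)

section \<open>Perturbation of extreme pairs\<close>

text \<open>Otherwise \<open>u\<close> jumps at some \<open>z\<close> over all levels between
  \<open>c\<close> and \<open>d\<close>, and \<open>z\<close> minimizes the slack along each of
  these lines. Then \<open>(z, c)\<close> and \<open>(z, d)\<close> are tight like the corners,
  forcing both \<open>z \<le> a\<close> and \<open>b \<le> z\<close>.\<close>

lemma gap_crossing:
  assumes corners: "(a, c) \<in> tight" "(b, d) \<in> tight" and less: "a < b" "c < d"
    and gap: "\<And>x y. (x, y) \<in> tight \<Longrightarrow> x \<le> a \<and> y \<le> c \<or> b \<le> x \<and> d \<le> y"
  obtains s t where "0 \<le> s" "s < t" "t \<le> 1" "c < u s" "u t < d"
proof (rule ccontr)
  assume "\<not> thesis"
  with that have jump: "u s \<le> c \<or> d \<le> u t" if "0 \<le> s" "s < t" "t \<le> 1" for s t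
    using \<open>0 \<le> s\<close> \<open>s < t\<close> \<open>t \<le> 1\<close> by (meson not_le)
  obtain z where z: "z \<in> {0..1}" "\<And>t. t \<in> {0..1} \<Longrightarrow> t < z \<Longrightarrow> u t \<le> (c + d) / 2"
      "\<And>t. t \<in> {0..1} \<Longrightarrow> z < t \<Longrightarrow> (c + d) / 2 \<le> u t"
    using mono_crossing[OF mono_u] by metis
  have left: "u t \<le> c" if "0 \<le> t" "t < z" for t
    using jump[of t "(t + z) / 2"] z(2)[of "(t + z) / 2"] z(1) that less by auto
  have right: "d \<le> u t" if "z < t" "t \<le> 1" for t
    using jump[of "(t + z) / 2" t] z(3)[of "(t + z) / 2"] z(1) that less by auto
  have min: "slack u v z y \<le> slack u v x y" if "x \<in> {0..1}" "c \<le> y" "y \<le> d" for x y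
  proof (cases "x \<le> z")
    case True
    then show ?thesis using that z(1) by (intro slack_decreasing) (auto intro: order_trans[OF left])
  next
    case False
    then show ?thesis using that z(1) by (intro slack_increasing) (auto intro: order_trans[OF _ right])
  qed
  have "(z, c) \<in> tight" "(z, d) \<in> tight"
    using min[of a c] min[of b d] corners less z(1) slack_nonneg[of z c] slack_nonneg[of z d] by auto
  from gap[OF this(1)] gap[OF this(2)] less show False by auto
qed

end

text \<open>If the slack covers a perturbation in both signs, both perturbed pairs are feasible and
  the given pair is their midpoint, so the perturbation vanishes almost everywhere. Only its
  integrals over the unit interval are recorded.\<close>

locale extreme_border_pair = border_pair +
  assumes extreme: "perturbation f \<Longrightarrow> perturbation g \<Longrightarrow>
    (\<And>x y. x \<in> {0..1} \<Longrightarrow> y \<in> {0..1} \<Longrightarrow>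
      \<bar>integral {x..1} (\<lambda>t. f (u t)) + integral {y..1} (\<lambda>t. g (v t))\<bar> \<le> slack u v x y) \<Longrightarrow>
    integral {0..1} (\<lambda>t. f (u t)) = 0 \<and> integral {0..1} (\<lambda>t. g (v t)) = 0"
begin

lemma extreme_border_pair_swap: "extreme_border_pair v u"
proof -
  interpret swap: border_pair v u by (rule border_pair_swap)
  show ?thesis
  proof
    fix f g
    assume pert: "perturbation f" "perturbation g"
      and bound: "\<And>x y. x \<in> {0..1} \<Longrightarrow> y \<in> {0..1} \<Longrightarrow>
        \<bar>integral {x..1} (\<lambda>t. f (v t)) + integral {y..1} (\<lambda>t. g (u t))\<bar> \<le> slack v u x y"
    have "\<bar>integral {x..1} (\<lambda>t. g (u t)) + integral {y..1} (\<lambda>t. f (v t))\<bar> \<le> slack u v x y"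
      if "x \<in> {0..1}" "y \<in> {0..1}" for x y
      using bound[OF that(2,1)] by (simp add: slack_commute[of v u] add.commute)
    from extreme[OF pert(2,1) this]
    show "integral {0..1} (\<lambda>t. f (v t)) = 0 \<and> integral {0..1} (\<lambda>t. g (u t)) = 0"
      by blast
  qed
qed

text \<open>Perturb \<open>u\<close> alone by a small tent on values below \<open>d\<close>. For
  \<open>y\<close> above the tent the slack dominates it; for lower \<open>y\<close> no tight point
  is near and the slack is bounded below.\<close>

lemma below_tight:
  assumes "\<And>x y. (x, y) \<in> tight \<Longrightarrow> d \<le> y" and st: "0 \<le> s" "s < t" "t \<le> 1" and "u t < d"
  shows "u s = 0"
proof (rule ccontr)
  assume "u s \<noteq> 0"
  with st have "0 < u s" using range_u[of s] by auto
  \<comment> \<open>Ending the tent strictly below \<open>d\<close> separates the half-plane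
    \<open>y \<le> d'\<close> from the tight set.\<close>
  define d' where "d' = (u t + d) / 2"
  have "d \<le> 1" using assms(1)[OF one_one_tight] .
  with \<open>u t < d\<close> have d': "u t < d'" "d' < d" "d' \<le> 1" by (auto simp: d'_def)
  have "closed {p::real \<times> real. snd p \<le> d'}"
    by (intro closed_Collect_le continuous_intros)
  moreover have "{p. snd p \<le> d'} \<inter> tight = {}"
    using assms(1) d'(2) by force
  ultimately obtain \<mu> where \<mu>: "0 < \<mu>" "\<mu> \<le> 1"
    "\<And>x y. x \<in> {0..1} \<Longrightarrow> y \<in> {0..1} \<Longrightarrow> (x, y) \<in> {p. snd p \<le> d'} \<Longrightarrow> \<mu> \<le> slack u v x y"
    using slack_bounded_below by blast
  have "\<mu> * integral {x..1} (\<lambda>t. tent 0 d' (u t)) \<le> slack u v x y"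
    if "x \<in> {0..1}" "y \<in> {0..1}" for x y
  proof (cases "y \<le> d'")
    case True
    have "\<mu> * integral {x..1} (\<lambda>t. tent 0 d' (u t)) \<le> \<mu> * 1"
      using tent_integral_bounds[OF that(1), of 0 d'] d' \<mu> by (intro mult_left_mono) auto
    then show ?thesis using \<mu>(3)[OF that] True by simp
  next
    case False
    have "\<mu> * integral {x..1} (\<lambda>t. tent 0 d' (u t)) \<le> 1 * integral {x..1} (\<lambda>t. tent 0 d' (u t))"
      using tent_integral_bounds[OF that(1), of 0 d'] d' \<mu> by (intro mult_right_mono) auto
    then show ?thesis using tent_integral_le_slack(1)[OF that, of 0 d'] d' False by simp
  qed
  then have "integral {0..1} (\<lambda>t. \<mu> * tent 0 d' (u t)) = 0"
    using extreme[of "\<lambda>t. \<mu> * tent 0 d' t" "\<lambda>_. 0"] perturbation_tent[of 0 d' \<mu>] \<mu> d'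
      tent_integral_bounds(1)[of _ 0 d']
    by (simp add: perturbation_def)
  then show False
    using tent_integral_pos[of 0 d' s t] \<mu> d' st \<open>0 < u s\<close> by simp
qed

text \<open>The tents for \<open>u\<close> and \<open>v\<close> get the weights \<open>J 0\<close>
  and \<open>- I 0\<close>, each the full integral of the other tent up to sign, so that the two
  total changes cancel. Near the upper corner the slack covers the tail integrals, near the lower
  corner the head integrals.\<close>

lemma no_gap:
  assumes corners: "(a, c) \<in> tight" "(b, d) \<in> tight" and less: "a < b" "c < d"
    and gap: "\<And>x y. (x, y) \<in> tight \<Longrightarrow> x \<le> a \<and> y \<le> c \<or> b \<le> x \<and> d \<le> y"
  shows False
proof -
  interpret swap: extreme_border_pair v u by (rule extreme_border_pair_swap)
  have swap_tight: "(y, x) \<in> swap.tight \<longleftrightarrow> (x, y) \<in> tight" for x y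
    by (auto simp: slack_commute[of v u])
  have unit: "0 \<le> a" "b \<le> 1" "0 \<le> c" "d \<le> 1" using corners by auto
  obtain s t where st: "0 \<le> s" "s < t" "t \<le> 1" "c < u s" "u t < d"
    using gap_crossing[OF corners less gap] .
  obtain s' t' where st': "0 \<le> s'" "s' < t'" "t' \<le> 1" "a < v s'" "v t' < b"
    using swap.gap_crossing[of c a d b] corners less gap unfolding swap_tight by blast
  \<comment> \<open>Shrinking the supports makes the slack control the perturbation near the two corners;
    elsewhere it is bounded below by compactness.\<close>
  define c' d' where "c' = (c + u s) / 2" and "d' = (d + u t) / 2"
  define a' b' where "a' = (a + v s') / 2" and "b' = (b + v t') / 2"
  have cd: "c < c'" "c' < u s" "u t < d'" "d' < d" "0 \<le> c'" "d' \<le> 1"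
    using st unit by (auto simp: c'_def d'_def)
  have ab: "a < a'" "a' < v s'" "v t' < b'" "b' < b" "0 \<le> a'" "b' \<le> 1"
    using st' unit by (auto simp: a'_def b'_def)
  have "u s \<le> u t" "v s' \<le> v t'"
    using st st' mono_onD[OF mono_u, of s t] mono_onD[OF mono_v, of s' t'] by auto
  then have "c' < d'" "a' < b'" using cd ab by auto
  define I J where "I x = integral {x..1} (\<lambda>t. tent c' d' (u t))"
    and "J y = integral {y..1} (\<lambda>t. tent a' b' (v t))" for x y
  have I: "0 \<le> I x" "I x \<le> I 0" "I 0 \<le> 1" if "x \<in> {0..1}" for x
    using tent_integral_bounds[OF that cd(5,6)] by (auto simp: I_def)
  have J: "0 \<le> J y" "J y \<le> J 0" "J 0 \<le> 1" if "y \<in> {0..1}" for y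
    using swap.tent_integral_bounds[OF that ab(5,6)] by (auto simp: J_def)
  have pos: "0 < I 0" "0 < J 0"
    using tent_integral_pos[OF cd(5,6) st(1-3) cd(2,3)]
      swap.tent_integral_pos[OF ab(5,6) st'(1-3) ab(2,3)] by (auto simp: I_def J_def)
  \<comment> \<open>The complement of two open quadrants; the gap places every tight point in one of
    them.\<close>
  define K where "K = {p::real \<times> real. (fst p \<le> b' \<or> snd p \<le> d') \<and> (a' \<le> fst p \<or> c' \<le> snd p)}"
  have "closed K"
    unfolding K_def
    by (intro closed_Collect_conj closed_Collect_disj closed_Collect_le continuous_intros)
  moreover have "K \<inter> tight = {}"
  proof -
    have "(x, y) \<notin> K" if "(x, y) \<in> tight" for x y
      using gap[OF that] cd ab \<open>c' < d'\<close> \<open>a' < b'\<close> unfolding K_def by auto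
    then show ?thesis by fastforce
  qed
  ultimately obtain \<mu> where \<mu>: "0 < \<mu>" "\<mu> \<le> 1"
    "\<And>x y. x \<in> {0..1} \<Longrightarrow> y \<in> {0..1} \<Longrightarrow> (x, y) \<in> K \<Longrightarrow> \<mu> \<le> slack u v x y"
    using slack_bounded_below by blast
  have bound: "\<bar>J 0 * A - I 0 * B\<bar> \<le> M" if "0 \<le> A" "A \<le> M" "0 \<le> B" "B \<le> M" for A B M
  proof -
    have "0 \<le> J 0 * A" "0 \<le> I 0 * B" using that pos by auto
    moreover have "J 0 * A \<le> 1 * M" "I 0 * B \<le> 1 * M"
      using that pos I[of 0] J[of 0] by (intro mult_mono; simp)+
    ultimately show ?thesis by linarith
  qed
  have main: "\<mu> * \<bar>J 0 * I x - I 0 * J y\<bar> \<le> slack u v x y"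
    if xy: "x \<in> {0..1}" "y \<in> {0..1}" for x y
  proof (cases "(x, y) \<in> K")
    case True
    have "\<bar>J 0 * I x - I 0 * J y\<bar> \<le> 1"
      using I[OF xy(1)] J[OF xy(2)] by (intro bound) auto
    then have "\<mu> * \<bar>J 0 * I x - I 0 * J y\<bar> \<le> \<mu> * 1"
      using \<mu> by (intro mult_left_mono) auto
    then show ?thesis using \<mu>(3)[OF xy True] by simp
  next
    case False
    then consider "b' \<le> x" "d' \<le> y" | "x \<le> a'" "y \<le> c'"
      unfolding K_def mem_Collect_eq fst_conv snd_conv by linarith
    then have "\<bar>J 0 * I x - I 0 * J y\<bar> \<le> slack u v x y"
    proof cases
      case 1
      then show ?thesis
        using I[OF xy(1)] J[OF xy(2)] tent_integral_le_slack(1)[OF xy cd(5,6)]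
          swap.tent_integral_le_slack(1)[OF xy(2,1) ab(5,6)]
        by (intro bound) (auto simp: I_def J_def slack_commute[of v u])
    next
      case 2
      \<comment> \<open>By the cancellation of the full integrals, the tails may be replaced by
        integrals over \<open>{0..x}\<close> and \<open>{0..y}\<close>.\<close>
      have "J 0 * I x - I 0 * J y = - (J 0 * (I 0 - I x) - I 0 * (J 0 - J y))"
        by (simp add: algebra_simps)
      moreover have "\<bar>J 0 * (I 0 - I x) - I 0 * (J 0 - J y)\<bar> \<le> slack u v x y"
        using 2 I[OF xy(1)] J[OF xy(2)] tent_integral_le_slack(2)[OF xy cd(5,6)]
          swap.tent_integral_le_slack(2)[OF xy(2,1) ab(5,6)]
          tent_integral_split[OF xy(1) cd(5,6)] swap.tent_integral_split[OF xy(2) ab(5,6)]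
        by (intro bound) (auto simp: I_def J_def slack_commute[of v u])
      ultimately show ?thesis by linarith
    qed
    moreover have "\<mu> * \<bar>J 0 * I x - I 0 * J y\<bar> \<le> \<bar>J 0 * I x - I 0 * J y\<bar>"
      using \<mu> by (intro mult_left_le_one_le) auto
    ultimately show ?thesis by (rule order_trans[rotated])
  qed
  have coeff: "\<bar>\<mu> * J 0\<bar> \<le> 1" "\<bar>- (\<mu> * I 0)\<bar> \<le> 1"
    using \<mu> pos I[of 0] J[of 0] by (auto simp: abs_mult intro: mult_le_one)
  have "\<mu> * J 0 * I 0 = 0"
  proof -
    have "\<bar>integral {x..1} (\<lambda>t. \<mu> * J 0 * tent c' d' (u t))
        + integral {y..1} (\<lambda>t. - (\<mu> * I 0) * tent a' b' (v t))\<bar> = \<mu> * \<bar>J 0 * I x - I 0 * J y\<bar>" for x y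
    proof -
      have "integral {x..1} (\<lambda>t. \<mu> * J 0 * tent c' d' (u t)) = \<mu> * J 0 * I x"
        "integral {y..1} (\<lambda>t. - (\<mu> * I 0) * tent a' b' (v t)) = - (\<mu> * I 0) * J y"
        unfolding I_def J_def by (rule integral_mult_right)+
      then have "integral {x..1} (\<lambda>t. \<mu> * J 0 * tent c' d' (u t))
        + integral {y..1} (\<lambda>t. - (\<mu> * I 0) * tent a' b' (v t)) = \<mu> * (J 0 * I x - I 0 * J y)"
        by (simp only:) (simp add: algebra_simps)
      then show ?thesis using \<mu>(1) by (simp add: abs_mult)
    qed
    then have "integral {0..1} (\<lambda>t. \<mu> * J 0 * tent c' d' (u t)) = 0"
      using extreme[OF perturbation_tent[OF cd(5,6) coeff(1)] perturbation_tent[OF ab(5,6) coeff(2)]]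
        main by simp
    then show ?thesis by (simp add: I_def)
  qed
  then show False using \<mu> pos by simp
qed

section \<open>Projection of the tight set and shape of extreme pairs\<close>

lemma tight_projection:
  obtains b d where "(b, d) \<in> tight" "\<And>x y. (x, y) \<in> tight \<Longrightarrow> b \<le> x \<and> d \<le> y"
    "\<And>x. b \<le> x \<Longrightarrow> x \<le> 1 \<Longrightarrow> \<exists>y. (x, y) \<in> tight"
proof -
  have slice: "compact {p \<in> tight. fst p = x}" for x
  proof -
    have "closed {p::real \<times> real. fst p = x}"
      by (intro closed_Collect_eq continuous_intros)
    moreover have "{p \<in> tight. fst p = x} = tight \<inter> {p. fst p = x}" by blast
    ultimately show ?thesis
      using compact_Int_closed[OF compact_tight] by simp
  qed
  define X where "X = fst ` tight"
  have X: "x \<in> X" if "(x, y) \<in> tight" for x y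
    using that unfolding X_def image_iff by (metis fst_conv)
  have nonempty: "{p \<in> tight. fst p = x} \<noteq> {}" if "x \<in> X" for x
    using that by (auto simp: X_def)
  have lowest: "\<exists>d. (x, d) \<in> tight \<and> (\<forall>y. (x, y) \<in> tight \<longrightarrow> d \<le> y)" if "x \<in> X" for x
    using continuous_attains_inf[OF slice nonempty[OF that], of snd]
    by (force intro: continuous_intros)
  have highest: "\<exists>d. (x, d) \<in> tight \<and> (\<forall>y. (x, y) \<in> tight \<longrightarrow> y \<le> d)" if "x \<in> X" for x
    using continuous_attains_sup[OF slice nonempty[OF that], of snd]
    by (force intro: continuous_intros)
  have "compact X"
    unfolding X_def by (intro compact_continuous_image compact_tight continuous_intros)
  have "1 \<in> X" using X[OF one_one_tight] .
  then obtain b where b: "b \<in> X" "\<And>x. x \<in> X \<Longrightarrow> b \<le> x"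
    using compact_attains_inf[OF \<open>compact X\<close>] by blast
  obtain d where d: "(b, d) \<in> tight" "\<And>y. (b, y) \<in> tight \<Longrightarrow> d \<le> y"
    using lowest[OF b(1)] by blast
  have all: "x \<in> X" if "b \<le> x" "x \<le> 1" for x
  proof (rule ccontr)
    assume "x \<notin> X"
    have "compact (X \<inter> {..x})" "compact (X \<inter> {x..})"
      using \<open>compact X\<close> by (auto intro: compact_Int_closed)
    moreover have "X \<inter> {..x} \<noteq> {}" "X \<inter> {x..} \<noteq> {}"
      using b \<open>1 \<in> X\<close> that by auto
    ultimately obtain l r where l: "l \<in> X \<inter> {..x}" "\<And>s. s \<in> X \<inter> {..x} \<Longrightarrow> s \<le> l"
      and r: "r \<in> X \<inter> {x..}" "\<And>s. s \<in> X \<inter> {x..} \<Longrightarrow> r \<le> s"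
      using compact_attains_sup[of "X \<inter> {..x}"] compact_attains_inf[of "X \<inter> {x..}"] by meson
    have lr: "l \<in> X" "r \<in> X" "l < x" "x < r"
      using l(1) r(1) \<open>x \<notin> X\<close> by (auto simp: less_le)
    \<comment> \<open>With \<open>l\<close> and \<open>r\<close> the points of the projection
      nearest to \<open>x\<close>, the highest tight point over \<open>l\<close> and the lowest over
      \<open>r\<close> are the corners of a gap.\<close>
    obtain y where y: "(l, y) \<in> tight" "\<And>y'. (l, y') \<in> tight \<Longrightarrow> y' \<le> y"
      using highest[OF lr(1)] by blast
    obtain y' where y': "(r, y') \<in> tight" "\<And>y. (r, y) \<in> tight \<Longrightarrow> y' \<le> y"
      using lowest[OF lr(2)] by blast
    have "y \<le> y'" using tight_chain[OF y(1) y'(1)] lr by simp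
    \<comment> \<open>At equal heights the whole segment between the corners would be tight,
      including a point over \<open>x\<close>.\<close>
    moreover have "y \<noteq> y'"
      using tight_between[OF y(1), of r x] y'(1) lr \<open>x \<notin> X\<close> X[of x y] by fastforce
    moreover have "s \<le> l \<and> t \<le> y \<or> r \<le> s \<and> y' \<le> t" if st: "(s, t) \<in> tight" for s t
    proof (cases "s \<le> x")
      case True
      then have "s \<le> l" using l(2) X[OF st] by auto
      moreover have "t \<le> y"
        using y(2)[of t] tight_chain[OF st y(1)] st \<open>s \<le> l\<close> by (cases "s = l") auto
      ultimately show ?thesis by blast
    next
      case False
      then have "r \<le> s" using r(2) X[OF st] by auto
      moreover have "y' \<le> t"
        using y'(2)[of t] tight_chain[OF y'(1) st] st \<open>r \<le> s\<close> by (cases "s = r") auto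
      ultimately show ?thesis by blast
    qed
    ultimately show False
      using no_gap[OF y(1) y'(1)] lr by (simp add: less_le)
  qed
  have "b \<le> x \<and> d \<le> y" if xy: "(x, y) \<in> tight" for x y
    using b(2)[OF X[OF xy]] d(2)[of y] xy tight_chain[OF d(1) xy] by (cases "x = b") auto
  moreover have "\<exists>y. (x, y) \<in> tight" if "b \<le> x" "x \<le> 1" for x
    using lowest[OF all[OF that]] by blast
  ultimately show ?thesis using that[OF d(1)] by blast
qed

text \<open>The assumptions on \<open>h\<close> say that \<open>h x\<close> is the supremum of
  \<open>{y \<in> {0..1}. v y < x}\<close>, or 0 if this set is empty. Beyond \<open>b\<close> the
  tight set pins down \<open>u\<close> and \<open>h\<close> alike; before \<open>b\<close> the value
  of \<open>h\<close> is \<open>d\<close> and \<open>u\<close> can only switch from 0 to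
  \<open>d\<close>.\<close>

lemma eq_truncated_inverse:
  assumes left_cont: "\<And>x. x \<in> {0<..1} \<Longrightarrow> continuous (at_left x) u"
    and h_range: "\<And>x. x \<in> {0..1} \<Longrightarrow> h x \<in> {0..1}"
    and below_h: "\<And>x y. x \<in> {0..1} \<Longrightarrow> y \<in> {0..1} \<Longrightarrow> y < h x \<Longrightarrow> v y < x"
    and above_h: "\<And>x y. x \<in> {0..1} \<Longrightarrow> y \<in> {0..1} \<Longrightarrow> v y < x \<Longrightarrow> y \<le> h x"
  obtains k N where "k \<in> {0..1}" "finite N"
    "\<And>x. x \<in> {0..1} - N \<Longrightarrow> u x = h x * indicator {k..1} x"
proof -
  interpret swap: extreme_border_pair v u by (rule extreme_border_pair_swap)
  have swap_tight: "(y, x) \<in> swap.tight \<longleftrightarrow> (x, y) \<in> tight" for x y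
    by (auto simp: slack_commute[of v u])
  obtain b d where bd: "(b, d) \<in> tight" "\<And>x y. (x, y) \<in> tight \<Longrightarrow> b \<le> x \<and> d \<le> y"
    "\<And>x. b \<le> x \<Longrightarrow> x \<le> 1 \<Longrightarrow> \<exists>y. (x, y) \<in> tight"
    using tight_projection by blast
  have v_sides: "t < y \<Longrightarrow> v t \<le> x" "y < t \<Longrightarrow> x \<le> v t" if "(x, y) \<in> tight" "t \<in> {0..1}" for x y t
    using swap.tight_sides[OF swap_tight[THEN iffD2, OF that(1)] that(2)] by blast+
  have u_below: "u s = 0 \<or> d \<le> u t" if "0 \<le> s" "s < t" "t \<le> 1" for s t
    using below_tight[of d s t] bd(2) that by force
  have v_below: "v s = 0 \<or> b \<le> v t" if "0 \<le> s" "s < t" "t \<le> 1" for s t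
    using swap.below_tight[of b s t] bd(2) that swap_tight by force
  have unit: "0 \<le> b" "b \<le> 1" "0 \<le> d" "d \<le> 1" using bd(1) by auto

  have upper: "u x = h x" if x: "b < x" "x \<le> 1" for x
  proof (rule antisym)
    have "u t \<le> h x" if t: "b \<le> t" "t < x" for t
    proof -
      \<comment> \<open>A tight point over an intermediate abscissa separates the two values:
        \<open>t < r\<close> gives \<open>u t \<le> y\<close>, and \<open>r < x\<close> gives
        \<open>y \<le> h x\<close>.\<close>
      define r where "r = (t + x) / 2"
      have r: "t < r" "r < x" "b \<le> r" "r \<le> 1" using t x by (auto simp: r_def)
      obtain y where y: "(r, y) \<in> tight" using bd(3) r by blast
      have "y \<le> h x"
      proof (rule dense_le)
        fix y' assume "y' < y"
        show "y' \<le> h x"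
        proof (cases "0 \<le> y'")
          case True
          then have "v y' < x" using v_sides(1)[OF y, of y'] \<open>y' < y\<close> y r by auto
          then show ?thesis using True above_h[of x y'] \<open>y' < y\<close> y x unit by auto
        next
          case False
          then show ?thesis using h_range[of x] x unit by auto
        qed
      qed
      moreover have "u t \<le> y" using tight_sides(1)[OF y, of t] t r unit by auto
      ultimately show ?thesis by linarith
    qed
    \<comment> \<open>Left-continuity carries the bound from \<open>t < x\<close> to
      \<open>x\<close> itself.\<close>
    then have "\<forall>\<^sub>F t in at_left x. u t \<le> h x"
      using x by (intro eventually_at_leftI[of b]) auto
    moreover have "(u \<longlongrightarrow> u x) (at_left x)"
      using left_cont[of x] x unit by (simp add: continuous_within)
    ultimately show "u x \<le> h x"
      by (intro tendsto_upperbound) auto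
    show "h x \<le> u x"
    proof (rule dense_le)
      fix y' assume y': "y' < h x"
      show "y' \<le> u x"
      proof (cases "0 \<le> y'")
        case True
        then have y'1: "y' \<in> {0..1}" using y' h_range[of x] x unit by auto
        then have "v y' < x" using below_h[of x y'] y' x unit by auto
        \<comment> \<open>Any abscissa \<open>r\<close> with \<open>b \<le> r\<close> and
          \<open>v y' < r < x\<close> will do: the tight point over it has height at least
          \<open>y'\<close>.\<close>
        define r where "r = (max b (v y') + x) / 2"
        have r: "b \<le> r" "v y' < r" "r < x" using x \<open>v y' < x\<close> by (auto simp: r_def)
        obtain y where y: "(r, y) \<in> tight" using bd(3) r x by force
        have "y' \<le> y" using v_sides(2)[OF y y'1] r by force
        also have "y \<le> u x" using tight_sides(2)[OF y, of x] r x unit by auto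
        finally show ?thesis .
      next
        case False
        then show ?thesis using range_u[of x] x unit by auto
      qed
    qed
  qed

  \<comment> \<open>A nonzero value at \<open>s\<close> would make \<open>v\<close> equal to
    \<open>b\<close> from there up to \<open>d\<close>. The slack would then stay zero along the
    segment from \<open>(b, d)\<close> down to \<open>(b, s)\<close>, against the minimality of
    \<open>d\<close>.\<close>
  have v_zero: "v s = 0" if s: "0 \<le> s" "s < d" for s
  proof (rule ccontr)
    assume "v s \<noteq> 0"
    have "v t = b" if "s < t" "t < d" for t
      using v_below[of s t] v_sides(1)[OF bd(1), of t] that s \<open>v s \<noteq> 0\<close> unit by auto
    then have "slack v u s b \<le> slack v u d b"
      using s unit by (intro swap.slack_increasing) auto
    then have "(b, s) \<in> tight"
      using bd(1) s slack_nonneg[of b s] by (auto simp: slack_commute[of v u])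
    then show False using bd(2) s by force
  qed
  have h_lower: "h x = d" if x: "0 < x" "x < b" for x
  proof (rule antisym)
    show "h x \<le> d"
    proof (rule ccontr)
      assume "\<not> h x \<le> d"
      then obtain y where y: "d < y" "y < h x" using dense not_le by blast
      then have "v y < x" "b \<le> v y"
        using below_h[of x y] h_range[of x] v_sides(2)[OF bd(1), of y] x unit by auto
      then show False using x by simp
    qed
    show "d \<le> h x"
    proof (rule dense_le)
      fix y assume "y < d"
      then show "y \<le> h x"
        using above_h[of x y] v_zero[of y] h_range[of x] x unit by (cases "0 \<le> y") auto
    qed
  qed

  \<comment> \<open>Level \<open>d / 2\<close> separates the values 0 and \<open>d\<close>, so its
    crossing is where \<open>u\<close> switches.\<close>
  obtain z where z: "z \<in> {0..1}" "\<And>t. t \<in> {0..1} \<Longrightarrow> t < z \<Longrightarrow> u t \<le> d / 2"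
      "\<And>t. t \<in> {0..1} \<Longrightarrow> z < t \<Longrightarrow> d / 2 \<le> u t"
    using mono_crossing[OF mono_u] by metis
  have u_zero: "u x = 0" if "0 \<le> x" "x < z" "x < b" for x
  proof (cases "d = 0")
    case True
    then show ?thesis
      using tight_sides(1)[OF bd(1), of x] range_u[of x] that unit by auto
  next
    case False
    then show ?thesis
      using u_below[of x "(x + z) / 2"] z(2)[of "(x + z) / 2"] z(1) that unit by auto
  qed
  have u_lower: "u x = d" if "z < x" "x < b" for x
  proof (rule antisym)
    show "u x \<le> d" using tight_sides(1)[OF bd(1), of x] that z(1) unit by auto
    show "d \<le> u x"
      using u_below[of "(x + z) / 2" x] z(3)[of "(x + z) / 2"] z(1) that unit range_u[of x] by auto
  qed
  show ?thesis
  \<comment> \<open>If the crossing lies beyond \<open>b\<close>, the truncation ends at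
    \<open>b\<close> instead.\<close>
  proof (rule that[of "min z b" "{0, z, b}"])
    show "u x = h x * indicator {min z b..1} x" if "x \<in> {0..1} - {0, z, b}" for x
      using that upper[of x] h_lower[of x] u_zero[of x] u_lower[of x]
      by (cases "x < b"; cases "x < z") (auto simp: indicator_def)
  qed (use z(1) unit in auto)
qed

end

section \<open>Conjugates and weak majorization\<close>

locale inverse_pair =
  fixes h v :: "real \<Rightarrow> real"
  assumes mono_v: "mono_on {0..1} v"
    and range_v: "\<And>t. t \<in> {0..1} \<Longrightarrow> v t \<in> {0..1}"
    and range_h: "\<And>x. x \<in> {0..1} \<Longrightarrow> h x \<in> {0..1}"
    and below_h: "\<And>x y. x \<in> {0..1} \<Longrightarrow> y \<in> {0..1} \<Longrightarrow> y < h x \<Longrightarrow> v y < x"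
    and above_h: "\<And>x y. x \<in> {0..1} \<Longrightarrow> y \<in> {0..1} \<Longrightarrow> v y < x \<Longrightarrow> y \<le> h x"
begin

lemma mono_h: "mono_on {0..1} h"
proof (rule mono_onI, rule ccontr)
  fix x x' assume xx: "x \<in> {0..1}" "x' \<in> {0..1}" "x \<le> x'" "\<not> h x \<le> h x'"
  then obtain y where y: "h x' < y" "y < h x" using dense not_le by blast
  then have "y \<in> {0..1}" using range_h[of x] range_h[of x'] xx by auto
  then show False using below_h[of x y] above_h[of x' y] xx y by auto
qed

text \<open>By Fubini this is \<open>\<integral>\<^sub>x\<^sup>1 h\<close>.\<close>

definition layer :: "real \<Rightarrow> real" where
  "layer x = integral {0..1} (\<lambda>y. min (1 - x) (1 - v y))"

lemma integrable_v: "0 \<le> a \<Longrightarrow> b \<le> 1 \<Longrightarrow> v integrable_on {a..b}"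
  by (rule integrable_on_mono_on) (auto intro: mono_on_subset[OF mono_v])

lemma integrable_layer:
  assumes "0 \<le> a" "b \<le> 1"
  shows "(\<lambda>y. min (1 - x) (1 - v y)) integrable_on {a..b}"
proof -
  have "mono_on {a..b} (\<lambda>y. max x (v y))"
    using assms by (intro mono_onI max.mono order_refl mono_onD[OF mono_v]) auto
  then have "(\<lambda>y. 1 - max x (v y)) integrable_on {a..b}"
    by (intro integrable_diff integrable_on_mono_on) (auto simp: mono_on_def)
  moreover have "1 - max x (v y) = min (1 - x) (1 - v y)" for y by auto
  ultimately show ?thesis by simp
qed

lemma layer_split:
  assumes "c \<in> {0..1}"
  shows "layer x = integral {0..c} (\<lambda>y. min (1 - x) (1 - v y))
    + integral {c..1} (\<lambda>y. min (1 - x) (1 - v y))"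
  unfolding layer_def
  using assms integrable_layer[of 0 1 x]
    Henstock_Kurzweil_Integration.integral_combine[of 0 c 1 "\<lambda>y. min (1 - x) (1 - v y)"]
  by simp

text \<open>Young's inequality: bound the minimum by \<open>1 - x\<close> on \<open>{0..y}\<close>
  and by \<open>1 - v s\<close> on \<open>{y..1}\<close>.\<close>

lemma layer_le:
  assumes "y \<in> {0..1}"
  shows "layer x \<le> 1 - x * y - integral {y..1} v"
proof -
  have "integral {0..y} (\<lambda>s. min (1 - x) (1 - v s)) \<le> integral {0..y} (\<lambda>s. 1 - x)"
    using assms by (intro integral_le integrable_layer) auto
  moreover have "integral {y..1} (\<lambda>s. min (1 - x) (1 - v s)) \<le> integral {y..1} (\<lambda>s. 1 - v s)"
    using assms by (intro integral_le integrable_layer integrable_diff integrable_v) auto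
  moreover have "integral {y..1} (\<lambda>s. 1 - v s) = 1 - y - integral {y..1} v"
    using assms by (subst integral_diff) (auto intro: integrable_v)
  ultimately show ?thesis
    using layer_split[OF assms, of x] assms by (simp add: algebra_simps)
qed

text \<open>The equality case \<open>y = h x\<close>: the generalized inverse marks where the
  minimum changes from \<open>1 - x\<close> to \<open>1 - v\<close>.\<close>

lemma layer_eq:
  assumes x: "x \<in> {0..1}"
  shows "layer x = 1 - x * h x - integral {h x..1} v"
proof -
  note hx = range_h[OF x]
  have "min (1 - x) (1 - v y) = 1 - x" if "y \<in> {0..h x} - {h x}" for y
    using below_h[OF x, of y] that hx by auto
  then have "integral {0..h x} (\<lambda>s. min (1 - x) (1 - v s)) = integral {0..h x} (\<lambda>s. 1 - x)"
    by (intro integral_spike[of "{h x}"]) simp_all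
  moreover have "min (1 - x) (1 - v y) = 1 - v y" if "y \<in> {h x..1} - {h x}" for y
    using above_h[OF x, of y] that hx by force
  then have "integral {h x..1} (\<lambda>s. min (1 - x) (1 - v s)) = integral {h x..1} (\<lambda>s. 1 - v s)"
    by (intro integral_spike[of "{h x}"]) simp_all
  moreover have "integral {h x..1} (\<lambda>s. 1 - v s) = 1 - h x - integral {h x..1} v"
    using hx by (subst integral_diff) (auto intro: integrable_v)
  ultimately show ?thesis
    using layer_split[OF hx, of x] hx by (simp add: algebra_simps)
qed

text \<open>Young's inequality at \<open>x'\<close> against equality at \<open>x\<close>:
  \<open>- h x\<close> is a supergradient of \<open>layer\<close> at \<open>x\<close>.\<close>

lemma layer_increment:
  assumes "x \<in> {0..1}" "x' \<in> {0..1}"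
  shows "(x' - x) * h x \<le> layer x - layer x'"
  using layer_eq[OF assms(1)] layer_le[OF range_h[OF assms(1)], of x'] by (simp add: algebra_simps)

text \<open>Both sides vanish at 1, and over \<open>{a..b}\<close> both decrease by an amount
  between \<open>(b - a) * h a\<close> and \<open>(b - a) * h b\<close>, so
  \<open>eq_of_bracketed_increments\<close> applies to their difference.\<close>

lemma integral_h_eq_layer:
  assumes x: "x \<in> {0..1}"
  shows "integral {x..1} h = layer x"
proof -
  have int: "h integrable_on {a..b}" if "0 \<le> a" "b \<le> 1" for a b
    using that by (intro integrable_on_mono_on mono_on_subset[OF mono_h]) auto
  define E where "E t = integral {t..1} h - layer t" for t
  have "\<bar>E b - E a\<bar> \<le> (b - a) * (h b - h a)" if "x \<le> a" "a \<le> b" "b \<le> 1" for a b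
  proof -
    have ab: "a \<in> {0..1}" "b \<in> {0..1}" "0 \<le> a" "b \<le> 1" using that x by auto
    have "integral {a..b} h + integral {b..1} h = integral {a..1} h"
      using that ab by (intro Henstock_Kurzweil_Integration.integral_combine int) auto
    moreover have "integral {a..b} (\<lambda>_. h a) \<le> integral {a..b} h"
      using ab by (intro integral_le int) (auto intro: mono_onD[OF mono_h])
    moreover have "integral {a..b} h \<le> integral {a..b} (\<lambda>_. h b)"
      using ab by (intro integral_le int) (auto intro: mono_onD[OF mono_h])
    ultimately show ?thesis
      using layer_increment[OF ab(1,2)] layer_increment[OF ab(2,1)] that
      by (simp add: E_def algebra_simps abs_le_iff)
  qed
  from eq_of_bracketed_increments[of x 1 E h, OF this] have "E x = E 1"
    using x by simp
  moreover have "layer 1 = integral {0..1} (\<lambda>_::real. 0)"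
    unfolding layer_def using range_v by (intro integral_cong) force
  ultimately show ?thesis by (simp add: E_def)
qed

text \<open>For fixed \<open>x\<close> the least slack over \<open>y\<close> is attained at
  \<open>h x\<close> and is the difference of the tail integrals of \<open>h\<close> and
  \<open>u\<close>.\<close>

lemma weakly_majorized_iff_slack:
  "u \<preceq>\<^sub>w h \<longleftrightarrow> (\<forall>x\<in>{0..1}. \<forall>y\<in>{0..1}. 0 \<le> slack u v x y)"
proof
  assume *: "u \<preceq>\<^sub>w h"
  show "\<forall>x\<in>{0..1}. \<forall>y\<in>{0..1}. 0 \<le> slack u v x y"
  proof (intro ballI)
    fix x y :: real assume xy: "x \<in> {0..1}" "y \<in> {0..1}"
    then have "integral {x..1} u \<le> layer x"
      using * integral_h_eq_layer[of x] unfolding weakly_majorized_def by metis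
    then show "0 \<le> slack u v x y"
      using layer_le[OF xy(2), of x] by (simp add: slack_def)
  qed
next
  assume *: "\<forall>x\<in>{0..1}. \<forall>y\<in>{0..1}. 0 \<le> slack u v x y"
  show "u \<preceq>\<^sub>w h"
    unfolding weakly_majorized_def
  proof
    fix x :: real assume x: "x \<in> {0..1}"
    then have "0 \<le> slack u v x (h x)" using * range_h by blast
    then show "integral {x..1} u \<le> integral {x..1} h"
      using layer_eq[OF x] integral_h_eq_layer[OF x] by (simp add: slack_def)
  qed
qed

end

section \<open>Reflection, and extreme points as extreme border pairs\<close>

definition reflect :: "(real \<Rightarrow> real) \<Rightarrow> real \<Rightarrow> real" where
  "reflect g y = 1 - g (1 - y)"

lemma left_cont_monoD:
  assumes "g \<in> left_cont_mono"
  shows "mono_on {0..1} g" "t \<in> {0..1} \<Longrightarrow> g t \<in> {0..1}"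
    "x \<in> {0<..1} \<Longrightarrow> continuous (at_left x) g"
  using assms by (auto simp: left_cont_mono_def image_subset_iff)

lemma integral_reflect_unit:
  fixes f :: "real \<Rightarrow> real"
  assumes "f integrable_on {0..1}"
  shows "integral {0..1} (\<lambda>t. f (1 - t)) = integral {0..1} f"
proof -
  have "(f has_integral integral {0..1} f) (cbox 0 1)"
    using assms by (simp add: integrable_integral)
  from has_integral_affinity[OF this, of "-1" 1]
  have "((\<lambda>t. f (1 - t)) has_integral integral {0..1} f) ((\<lambda>t. 1 - t) ` {0..1})"
    by (simp add: algebra_simps)
  moreover have "(\<lambda>t::real. 1 - t) ` {0..1} = {0..1}"
    by simp
  ultimately show ?thesis by (simp add: integral_unique)
qed

lemma inverse_pair_conjugate:
  assumes "g \<in> left_cont_mono"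
  shows "inverse_pair (conjugate g) (reflect g)"
proof
  have mono: "mono_on {0..1} g" and range: "\<And>t. t \<in> {0..1} \<Longrightarrow> g t \<in> {0..1}"
    using left_cont_monoD[OF assms] by blast+
  show "mono_on {0..1} (reflect g)"
    by (rule mono_onI) (auto simp: reflect_def intro!: mono_onD[OF mono])
  show "reflect g t \<in> {0..1}" if "t \<in> {0..1}" for t
    using range[of "1 - t"] that by (auto simp: reflect_def)
  define S where "S z = {x \<in> {0..1}. g x > z}" for z
  have bdd: "bdd_below (S z)" for z
    by (rule bdd_belowI[of _ 0]) (auto simp: S_def)
  \<comment> \<open>Substituting \<open>1 - y\<close> for the argument of \<open>g\<close> turns
    this infimum into a supremum over \<open>reflect g y < x\<close>; the default 1 of
    \<open>gen_inverse\<close> becomes 0.\<close>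
  have conj: "conjugate g x = (if S (1 - x) = {} then 0 else 1 - Inf (S (1 - x)))" for x
    unfolding conjugate_def gen_inverse_def S_def[symmetric] by simp
  show "conjugate g x \<in> {0..1}" if "x \<in> {0..1}" for x
  proof (cases "S (1 - x) = {}")
    case False
    then obtain s where "s \<in> S (1 - x)" by blast
    then have "Inf (S (1 - x)) \<le> 1"
      using cInf_lower2[OF _ _ bdd, of s "1 - x" 1] by (auto simp: S_def)
    moreover have "0 \<le> Inf (S (1 - x))"
      using False by (intro cInf_greatest) (auto simp: S_def)
    ultimately show ?thesis by (simp add: conj)
  qed (simp add: conj)
  show "reflect g y < x" if "x \<in> {0..1}" "y \<in> {0..1}" "y < conjugate g x" for x y
  proof -
    have "S (1 - x) \<noteq> {}" "Inf (S (1 - x)) < 1 - y"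
      using that by (auto simp: conj split: if_splits)
    then obtain s where "s \<in> S (1 - x)" "s < 1 - y"
      using cInf_lessD by blast
    then show ?thesis
      using that mono_onD[OF mono, of s "1 - y"] by (auto simp: S_def reflect_def)
  qed
  show "y \<le> conjugate g x" if "x \<in> {0..1}" "y \<in> {0..1}" "reflect g y < x" for x y
  proof -
    have "1 - y \<in> S (1 - x)" using that by (auto simp: S_def reflect_def)
    then show ?thesis using cInf_lower[OF _ bdd, of "1 - y" "1 - x"] by (auto simp: conj)
  qed
qed

text \<open>Replaces majorization by a conjugate, which is not linear in \<open>q2\<close>, by
  inequalities affine in both functions.\<close>

lemma feasible_iff_slack:
  "(q1, q2) \<in> feasible \<longleftrightarrow> q1 \<in> left_cont_mono \<and> q2 \<in> left_cont_mono \<and>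
    (\<forall>x\<in>{0..1}. \<forall>y\<in>{0..1}. 0 \<le> slack q1 (reflect q2) x y)"
proof (cases "q2 \<in> left_cont_mono")
  case True
  then show ?thesis
    using inverse_pair.weakly_majorized_iff_slack[OF inverse_pair_conjugate[OF True], of q1]
    by (simp only: feasible_def mem_Collect_eq case_prod_conv simp_thms)
qed (simp add: feasible_def)

lemma perturbation_uminus: "perturbation f \<Longrightarrow> perturbation (\<lambda>t. - f t)"
  by (simp add: perturbation_def abs_minus_commute)

lemma perturbation_reflect:
  assumes "perturbation f"
  shows "perturbation (\<lambda>t. f (1 - t))"
proof -
  have "\<bar>f (1 - s) - f (1 - t)\<bar> \<le> \<bar>(1 - s) - (1 - t)\<bar>" for s t
    using assms unfolding perturbation_def by blast
  then have "\<bar>f (1 - s) - f (1 - t)\<bar> \<le> \<bar>s - t\<bar>" for s t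
    by (simp add: abs_minus_commute)
  then show ?thesis
    using assms by (simp add: perturbation_def)
qed

lemma left_cont_mono_perturbation:
  assumes g: "g \<in> left_cont_mono" and f: "perturbation f"
  shows "(\<lambda>t. g t + f (g t)) \<in> left_cont_mono"
proof -
  have "1-lipschitz_on UNIV f"
    using f by (auto simp: lipschitz_on_def perturbation_def dist_real_def)
  then have "continuous_on UNIV f"
    by (rule lipschitz_on_continuous_on)
  then have "isCont f t" for t
    by (simp add: continuous_on_eq_continuous_at)
  then have "continuous (at_left x) (\<lambda>t. g t + f (g t))" if "continuous (at_left x) g" for x
    using that continuous_within_compose3[where g = f, OF _ that] by (simp add: continuous_add)
  moreover have "g t + f (g t) \<in> {0..1}" if "t \<in> {0..1}" for t
    using left_cont_monoD(2)[OF g that] by (intro perturbation_range[OF f])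
  moreover have "mono_on {0..1} (\<lambda>t. g t + f (g t))"
    using g by (intro mono_on_add_perturbation f) (auto simp: left_cont_mono_def)
  ultimately show ?thesis
    using g by (auto simp: left_cont_mono_def)
qed

lemma integral_eq_0_of_AE:
  fixes f :: "real \<Rightarrow> real"
  assumes "AE x\<in>{a..b} in lborel. f x = 0"
  shows "integral {a..b} f = 0"
proof -
  obtain N where N: "N \<in> null_sets lborel" "\<And>x. x \<in> space lborel - N \<Longrightarrow> x \<in> {a..b} \<longrightarrow> f x = 0"
    using AE_E3[OF assms] by blast
  then have "negligible N"
    by (simp add: negligible_iff_null_sets null_sets_completionI)
  then have "integral {a..b} f = integral {a..b} (\<lambda>_. 0)"
    using N(2) by (intro integral_spike) auto
  then show ?thesis by simp
qed

lemma extreme_border_pair_of_extreme_point: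
  assumes feas: "(q1, q2) \<in> feasible"
    and ext: "(ae_class q1, ae_class q2) extreme_point_of feasible_classes"
  shows "extreme_border_pair q1 (reflect q2)"
proof -
  have q: "q1 \<in> left_cont_mono" "q2 \<in> left_cont_mono"
    and nonneg: "\<And>x y. x \<in> {0..1} \<Longrightarrow> y \<in> {0..1} \<Longrightarrow> 0 \<le> slack q1 (reflect q2) x y"
    using feas by (auto simp: feasible_iff_slack)
  interpret inverse_pair "conjugate q2" "reflect q2"
    by (rule inverse_pair_conjugate[OF q(2)])
  interpret border_pair q1 "reflect q2"
    using left_cont_monoD[OF q(1)] nonneg mono_v range_v by unfold_locales
  interpret swap: border_pair "reflect q2" q1 by (rule border_pair_swap)
  show ?thesis
  proof
    fix f g
    assume f: "perturbation f" and g: "perturbation g"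
      and bound: "\<And>x y. x \<in> {0..1} \<Longrightarrow> y \<in> {0..1} \<Longrightarrow>
        \<bar>integral {x..1} (\<lambda>t. f (q1 t)) + integral {y..1} (\<lambda>t. g (reflect q2 t))\<bar>
          \<le> slack q1 (reflect q2) x y"
    define P where "P f = (\<lambda>t. q1 t + f (q1 t))" for f :: "real \<Rightarrow> real"
    \<comment> \<open>Chosen so that \<open>reflect (Q g)\<close> is \<open>reflect q2\<close>
      perturbed by \<open>g\<close>.\<close>
    define Q where "Q g = (\<lambda>s. q2 s - g (1 - q2 s))" for g :: "real \<Rightarrow> real"
    have feas': "(P f', Q g') \<in> feasible"
      if f': "perturbation f'" and g': "perturbation g'"
        and le: "\<And>x y. x \<in> {0..1} \<Longrightarrow> y \<in> {0..1} \<Longrightarrow>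
          integral {x..1} (\<lambda>t. f' (q1 t)) + integral {y..1} (\<lambda>t. g' (reflect q2 t))
            \<le> slack q1 (reflect q2) x y"
      for f' g'
    proof -
      have "P f' \<in> left_cont_mono" "Q g' \<in> left_cont_mono"
        using left_cont_mono_perturbation[OF q(1) f']
          left_cont_mono_perturbation[OF q(2) perturbation_uminus[OF perturbation_reflect[OF g']]]
        by (simp_all add: P_def Q_def)
      moreover have "0 \<le> slack (P f') (reflect (Q g')) x y" if "x \<in> {0..1}" "y \<in> {0..1}" for x y
      proof -
        have "integral {x..1} (P f') = integral {x..1} q1 + integral {x..1} (\<lambda>t. f' (q1 t))"
          unfolding P_def
          using that f' by (intro integral_add integrable_u integrable_perturbation_u) auto
        moreover have "reflect (Q g') = (\<lambda>t. reflect q2 t + g' (reflect q2 t))"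
          by (auto simp: reflect_def Q_def)
        then have "integral {y..1} (reflect (Q g'))
            = integral {y..1} (reflect q2) + integral {y..1} (\<lambda>t. g' (reflect q2 t))"
          using that g'
          by (simp only:) (intro integral_add integrable_v swap.integrable_perturbation_u; simp)
        ultimately show ?thesis using le[OF that] by (simp add: slack_def)
      qed
      ultimately show ?thesis by (simp add: feasible_iff_slack)
    qed
    define A where "A = (ae_class (P f), ae_class (Q g))"
    define B where "B = (ae_class (P (\<lambda>t. - f t)), ae_class (Q (\<lambda>t. - g t)))"
    have "(P f, Q g) \<in> feasible" "(P (\<lambda>t. - f t), Q (\<lambda>t. - g t)) \<in> feasible"
      using bound by (auto intro!: feas' f g perturbation_uminus simp: abs_le_iff)
    then have "A \<in> feasible_classes" "B \<in> feasible_classes"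
      by (auto simp: A_def B_def feasible_classes_def image_iff intro: bexI[rotated])
    moreover have "midpoint A B = (ae_class q1, ae_class q2)"
      by (auto simp: A_def B_def midpoint_def P_def Q_def plus_ae_fun.abs_eq scaleR_ae_fun.abs_eq
          ae_fun.abs_eq_iff ae_eq_def field_simps)
    \<comment> \<open>The midpoint of two distinct classes would lie in their open segment, against
      extremality.\<close>
    ultimately have "A = B"
      using ext midpoint_in_open_segment[of A B] by (auto simp: extreme_point_of_def)
    then have "ae_eq (P f) (P (\<lambda>t. - f t))" "ae_eq (Q g) (Q (\<lambda>t. - g t))"
      by (simp_all add: A_def B_def ae_fun.abs_eq_iff)
    then have "AE t\<in>{0..1} in lborel. f (q1 t) = 0" "AE t\<in>{0..1} in lborel. g (1 - q2 t) = 0"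
      by (simp_all add: ae_eq_def P_def Q_def)
    then have "integral {0..1} (\<lambda>t. f (q1 t)) = 0" "integral {0..1} (\<lambda>t. g (1 - q2 t)) = 0"
      by (simp_all add: integral_eq_0_of_AE)
    moreover have "integral {0..1} (\<lambda>t. g (1 - q2 t)) = integral {0..1} (\<lambda>t. g (reflect q2 t))"
      using integral_reflect_unit[OF swap.integrable_perturbation_u[OF g]] by (simp add: reflect_def)
    ultimately show "integral {0..1} (\<lambda>t. f (q1 t)) = 0 \<and>
        integral {0..1} (\<lambda>t. g (reflect q2 t)) = 0"
      by simp
  qed
qed

theorem proposition7:
  fixes q1 q2 :: "real \<Rightarrow> real"
  assumes "(q1, q2) \<in> feasible"
    and "(ae_class q1, ae_class q2) extreme_point_of feasible_classes"
  shows "\<exists>k\<in>{0..1}. AE x\<in>{0..1} in lborel. q1 x = conjugate q2 x * indicator {k..1} x"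
proof -
  interpret extreme_border_pair q1 "reflect q2"
    using assms by (rule extreme_border_pair_of_extreme_point)
  have q: "q1 \<in> left_cont_mono" "q2 \<in> left_cont_mono"
    using assms(1) by (auto simp: feasible_def)
  interpret inverse_pair "conjugate q2" "reflect q2"
    by (rule inverse_pair_conjugate[OF q(2)])
  have "continuous (at_left x) q1" if "x \<in> {0<..1}" for x
    using q(1) that by (auto simp: left_cont_mono_def)
  then obtain k N where k: "k \<in> {0..1}" and N: "finite N"
    "\<And>x. x \<in> {0..1} - N \<Longrightarrow> q1 x = conjugate q2 x * indicator {k..1} x"
    using eq_truncated_inverse[of "conjugate q2"] range_h below_h above_h by blast
  have "AE x in lborel. x \<notin> N"
    by (intro AE_not_in finite_imp_null_set_lborel N)
  then have "AE x\<in>{0..1} in lborel. q1 x = conjugate q2 x * indicator {k..1} x"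
    by eventually_elim (use N(2) in auto)
  with k show ?thesis by blast
qed

end
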